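(* Let $p$ and $q$ be nonzero integers with $p - q = 1$ and $q \neq 1$. Let $(U_n)_{n\ge0}$ and $(V_n)_{n\ge0}$ be defined by $U_0=0$, $U_1=1$, $V_0=2$, $V_1=p$, and $U_n = pU_{n-1}-qU_{n-2}$, $V_n = pV_{n-1}-qV_{n-2}$ for $n\ge2$. Then for all $n \geq 1$, $$\sum_{i=1}^n i\, V_i = n U_{n+1} - \frac{q U_n - n}{q-1} + \binom{n+1}{2}.$$
   Context: $(U_n)$ and $(V_n)$ are the Lucas sequences of the first and second kind with parameters $p,q$. *)

theory Defs
  imports Complex_Main
begin

fun lucas_U :: "int \<Rightarrow> int \<Rightarrow> nat \<Rightarrow> int" where
  "lucas_U p q 0 = 0"
| "lucas_U p q (Suc 0) = 1"
| "lucas_U p q (Suc (Suc n)) = p * lucas_U p q (Suc n) - q * lucas_U p q n"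

fun lucas_V :: "int \<Rightarrow> int \<Rightarrow> nat \<Rightarrow> int" where
  "lucas_V p q 0 = 2"
| "lucas_V p q (Suc 0) = p"
| "lucas_V p q (Suc (Suc n)) = p * lucas_V p q (Suc n) - q * lucas_V p q n"

end

theory Submission
  imports Defs
begin

text \<open>For \<open>p = q + 1\<close> the characteristic roots are \<open>1\<close> and \<open>q\<close>, so that
  \<open>V\<^sub>n = q ^ n + 1\<close> and \<open>(q - 1) U\<^sub>n = q ^ n - 1\<close>.
  The identity follows by induction: the quotient on the right-hand side grows by
  \<open>(q ^ (n + 1) - 1) / (q - 1) = U\<^sub>n\<^sub>+\<^sub>1\<close> in each step.\<close>

lemma lucas_V_roots_1_q: "lucas_V (q + 1) q n = q ^ n + 1"
  by (induction "q + 1" q n rule: lucas_V.induct) (simp_all add: algebra_simps)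

text \<open>With \<open>p = q + 1\<close> the recurrence reads U(n+2) - U(n+1) = q (U(n+1) - U(n)),
  so consecutive differences are geometric, starting from 1.\<close>

lemma lucas_U_Suc_roots_1_q: "lucas_U (q + 1) q (Suc n) = lucas_U (q + 1) q n + q ^ n"
  by (induction n) (simp_all add: algebra_simps)

lemma lucas_U_roots_1_q: "(q - 1) * lucas_U (q + 1) q n = q ^ n - 1"
proof (induction n)
  case (Suc n)
  then show ?case
    unfolding lucas_U_Suc_roots_1_q distrib_left by (simp add: algebra_simps)
qed simp

text \<open>Allowing \<open>n = 0\<close> gives the induction a base case in which both sides
  vanish.\<close>

lemma sum_mult_lucas_V_roots_1_q:
  fixes q :: int
  assumes "q \<noteq> 1"
  shows "(\<Sum>i=1..n. rat_of_nat i * rat_of_int (lucas_V (q + 1) q i)) =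
    rat_of_nat n * rat_of_int (lucas_U (q + 1) q (Suc n))
    - (rat_of_int q * rat_of_int (lucas_U (q + 1) q n) - rat_of_nat n) / (rat_of_int q - 1)
    + rat_of_nat (Suc n choose 2)"
proof (induction n)
  case 0
  then show ?case by simp
next
  case (Suc n)
  define x U where "x = rat_of_int q" and "U k = rat_of_int (lucas_U (q + 1) q k)" for k
  have U_Suc: "U (Suc k) = U k + x ^ k" for k
    unfolding U_def x_def lucas_U_Suc_roots_1_q by simp
  have "rat_of_int ((q - 1) * lucas_U (q + 1) q (Suc n)) = rat_of_int (q ^ Suc n - 1)"
    by (simp only: lucas_U_roots_1_q)
  then have "(x - 1) * U (Suc n) = x ^ Suc n - 1"
    by (simp add: U_def x_def del: lucas_U.simps)
  moreover have "x - 1 \<noteq> 0"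
    using assms by (simp add: x_def)
  ultimately have "U (Suc n) = (x ^ Suc n - 1) / (x - 1)"
    by (simp add: field_simps)
  \<comment> \<open>The numerators differ by \<open>x * (U (Suc n) - U n) - 1\<close>, which is
    \<open>x ^ Suc n - 1\<close> by \<open>U_Suc\<close>.\<close>
  also have "\<dots> = (x * U (Suc n) - rat_of_nat (Suc n)) / (x - 1)
      - (x * U n - rat_of_nat n) / (x - 1)"
    unfolding U_Suc diff_divide_distrib[symmetric] by (simp add: algebra_simps)
  finally have quotient: "(x * U (Suc n) - rat_of_nat (Suc n)) / (x - 1) =
      (x * U n - rat_of_nat n) / (x - 1) + U (Suc n)"
    by simp
  have V: "rat_of_int (lucas_V (q + 1) q (Suc n)) = x ^ Suc n + 1"
    by (simp add: lucas_V_roots_1_q x_def)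
  have binomial: "Suc (Suc n) choose 2 = (Suc n choose 2) + Suc n"
    by (simp add: numeral_2_eq_2)
  have "(\<Sum>i=1..Suc n. rat_of_nat i * rat_of_int (lucas_V (q + 1) q i)) =
      rat_of_nat n * U (Suc n) - (x * U n - rat_of_nat n) / (x - 1)
      + rat_of_nat (Suc n choose 2) + rat_of_nat (Suc n) * (x ^ Suc n + 1)"
    using Suc.IH V by (simp add: U_def x_def del: lucas_U.simps lucas_V.simps)
  \<comment> \<open>The new summand splits: its part with \<open>x ^ Suc n\<close> turns
    \<open>U (Suc n)\<close> into \<open>U (Suc (Suc n))\<close>, and its part \<open>Suc n\<close>
    is the growth of the binomial. Raising the coefficient \<open>n\<close> to \<open>Suc n\<close>
    costs one extra \<open>U (Suc n)\<close>, which the growth of the quotient cancels.\<close>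
  also have "\<dots> = rat_of_nat (Suc n) * U (Suc (Suc n))
      - (x * U (Suc n) - rat_of_nat (Suc n)) / (x - 1) + rat_of_nat (Suc (Suc n) choose 2)"
    unfolding quotient U_Suc[of "Suc n"] binomial by (simp add: algebra_simps)
  finally show ?case
    unfolding U_def x_def .
qed

theorem theorem4p5:
  fixes p q :: int and n :: nat
  assumes "p \<noteq> 0" and "q \<noteq> 0" and "p - q = 1" and "q \<noteq> 1" and "n \<ge> 1"
  shows "(\<Sum>i=1..n. rat_of_nat i * rat_of_int (lucas_V p q i)) =
    rat_of_nat n * rat_of_int (lucas_U p q (n + 1))
    - (rat_of_int q * rat_of_int (lucas_U p q n) - rat_of_nat n) / (rat_of_int q - 1)
    + rat_of_nat ((n + 1) choose 2)"
proof -
  have "p = q + 1"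
    using assms(3) by simp
  then show ?thesis
    using sum_mult_lucas_V_roots_1_q[OF assms(4), of n] by (simp only: Suc_eq_plus1)
qed

end
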